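(* Let $n\ge 3$ and, for a linear equation $$y^{(n)}+c_{n-1}(x)\,y^{(n-1)}+\dots+c_0(x)\,y=0,$$ define $$\begin{aligned}I_n(c_0,\dots,c_{n-1})={}&\frac{n-2}{n}c_{n-1}c_{n-2}-\frac{(n-1)(n-2)}{3n^2}c_{n-1}^3+\frac{n-2}{2}c_{n-2}'\\&-\frac{(n-1)(n-2)}{2n}c_{n-1}c_{n-1}'-\frac{(n-1)(n-2)}{12}c_{n-1}''-c_{n-3}.\end{aligned}$$ Then $I_n$ is a semi-invariant of the linear equation, of index $3$: if an invertible change of variables $x=f(z)$, $y=g(z)w(z)$ transforms the equation into $$w^{(n)}+Q_{n-1}(z)\,w^{(n-1)}+\dots+Q_0(z)\,w=0,$$ then $$I_n(Q_0,Q_1,\dots,Q_{n-1})=f'(z)^3\,I_n(c_0,c_1,\dots,c_{n-1}).$$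
   Context: All functions are smooth and all changes of variables are local, with $f'\neq0$ and $g\neq 0$. In $I_n(c_0,\dots,c_{n-1})$ primes on the $c_j$ denote derivatives with respect to $x$, and the right-hand side of the transformation formula is evaluated at $x=f(z)$; in $I_n(Q_0,\dots,Q_{n-1})$ the same expression is formed with $Q_j$ in place of $c_j$ and derivatives taken with respect to $z$. A semi-invariant is a function of the coefficients of the equation and their derivatives whose expression is unchanged when the dependent variable alone is transformed ($y=g(x)w$); it has index $\mu$ if under $x=f(z)$, $y=g(z)w(z)$ it satisfies $F(Q)=(dx/dz)^\mu F(c)$. *)

theory Defs
  imports "HOL-Analysis.Analysis"
begin

(* Working over 'a::real_normed_field treats the real and the complex case at once; on an open
   set "smooth_on" is then the usual smoothness over the reals, respectively holomorphy. *)
definition smooth_on :: "('a::real_normed_field \<Rightarrow> 'a) \<Rightarrow> 'a set \<Rightarrow> bool" where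
  "smooth_on f S \<longleftrightarrow> (\<forall>k. \<forall>x\<in>S. ((deriv ^^ k) f) field_differentiable (at x))"

(* The family c 0, ..., c (n - 1) stands for the coefficients of
   y^(n) + c_{n-1} y^(n-1) + ... + c_0 y = 0; the values c j with j \<ge> n play no role. *)
definition lin_op :: "nat \<Rightarrow> (nat \<Rightarrow> 'a::real_normed_field \<Rightarrow> 'a) \<Rightarrow> ('a \<Rightarrow> 'a) \<Rightarrow> 'a \<Rightarrow> 'a" where
  "lin_op n c y x = (deriv ^^ n) y x + (\<Sum>j<n. c j x * (deriv ^^ j) y x)"

definition smooth_coeffs :: "nat \<Rightarrow> (nat \<Rightarrow> 'a::real_normed_field \<Rightarrow> 'a) \<Rightarrow> 'a set \<Rightarrow> bool" where
  "smooth_coeffs n c S \<longleftrightarrow> (\<forall>j<n. smooth_on (c j) S)"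

(* The local change of variables x = f(z), y = g(z) w(z), for z in the open set J. *)
definition change_of_variables :: "'a::real_normed_field set \<Rightarrow> ('a \<Rightarrow> 'a) \<Rightarrow> ('a \<Rightarrow> 'a) \<Rightarrow> bool" where
  "change_of_variables J f g \<longleftrightarrow>
     open J \<and> smooth_on f J \<and> smooth_on g J \<and> inj_on f J \<and>
     (\<forall>z\<in>J. deriv f z \<noteq> 0) \<and> (\<forall>z\<in>J. g z \<noteq> 0)"

(* The equation is a condition on the jet of y at each point x.  It is transformed into the
   equation with coefficients Q if, for any functions related by y(f(z)) = g(z) w(z), solutions
   or not, y satisfies the old equation at x = f(z) exactly when w satisfies the new one at z. *)
definition transforms_into ::
  "nat \<Rightarrow> 'a::real_normed_field set \<Rightarrow> ('a \<Rightarrow> 'a) \<Rightarrow> ('a \<Rightarrow> 'a) \<Rightarrow>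
   (nat \<Rightarrow> 'a \<Rightarrow> 'a) \<Rightarrow> (nat \<Rightarrow> 'a \<Rightarrow> 'a) \<Rightarrow> bool" where
  "transforms_into n J f g c Q \<longleftrightarrow>
     (\<forall>y w. smooth_on y (f ` J) \<and> smooth_on w J \<and> (\<forall>z\<in>J. y (f z) = g z * w z) \<longrightarrow>
        (\<forall>z\<in>J. lin_op n c y (f z) = 0 \<longleftrightarrow> lin_op n Q w z = 0))"

definition differential_expression ::
  "nat \<Rightarrow> ((nat \<Rightarrow> 'a::real_normed_field \<Rightarrow> 'a) \<Rightarrow> 'a \<Rightarrow> 'a) \<Rightarrow> bool" where
  "differential_expression n F \<longleftrightarrow>
     (\<exists>m \<Phi>. \<forall>S c. open S \<and> smooth_coeffs n c S \<longrightarrow>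
        (\<forall>x\<in>S. F c x = \<Phi> (\<lambda>j k. if j < n \<and> k \<le> m then (deriv ^^ k) (c j) x else 0)))"

definition semi_invariant ::
  "nat \<Rightarrow> ((nat \<Rightarrow> 'a::real_normed_field \<Rightarrow> 'a) \<Rightarrow> 'a \<Rightarrow> 'a) \<Rightarrow> bool" where
  "semi_invariant n F \<longleftrightarrow>
     differential_expression n F \<and>
     (\<forall>J g c Q. change_of_variables J (\<lambda>x. x) g \<and> smooth_coeffs n c J \<and> smooth_coeffs n Q J \<and>
        transforms_into n J (\<lambda>x. x) g c Q \<longrightarrow> (\<forall>x\<in>J. F Q x = F c x))"

definition has_index ::
  "nat \<Rightarrow> ((nat \<Rightarrow> 'a::real_normed_field \<Rightarrow> 'a) \<Rightarrow> 'a \<Rightarrow> 'a) \<Rightarrow> nat \<Rightarrow> bool" where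
  "has_index n F \<mu> \<longleftrightarrow>
     (\<forall>J f g c Q. change_of_variables J f g \<and> smooth_coeffs n c (f ` J) \<and> smooth_coeffs n Q J \<and>
        transforms_into n J f g c Q \<longrightarrow> (\<forall>z\<in>J. F Q z = deriv f z ^ \<mu> * F c (f z)))"

definition I_inv :: "nat \<Rightarrow> (nat \<Rightarrow> 'a::real_normed_field \<Rightarrow> 'a) \<Rightarrow> 'a \<Rightarrow> 'a" where
  "I_inv n c x =
     (of_nat n - 2) / of_nat n * c (n - 1) x * c (n - 2) x
     - (of_nat n - 1) * (of_nat n - 2) / (3 * of_nat n ^ 2) * c (n - 1) x ^ 3
     + (of_nat n - 2) / 2 * deriv (c (n - 2)) x
     - (of_nat n - 1) * (of_nat n - 2) / (2 * of_nat n) * c (n - 1) x * deriv (c (n - 1)) x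
     - (of_nat n - 1) * (of_nat n - 2) / 12 * (deriv ^^ 2) (c (n - 1)) x
     - c (n - 3) x"

end

theory Submission
  imports Defs
begin

text \<open>
  The coefficients of the transformed equation are read off by testing both operators on a few
  functions.  At a point \<open>z\<close> take \<open>y = (x - f z)^k / k!\<close>, whose image is
  \<open>w = u^k / k! * h\<close> with \<open>u = f - f z\<close> and \<open>h = 1 / g\<close>.  The old operator sends \<open>y\<close> to
  \<open>c k (f z)\<close> if \<open>k < n\<close> and to \<open>1\<close> if \<open>k = n\<close>, so
  \<open>y = (x - f z)^k / k! - c k (f z) * (x - f z)^n / n!\<close> satisfies the old equation at \<open>f z\<close>.
  Hence its image satisfies the new equation at \<open>z\<close>, which says that the new operator sends
  \<open>u^k / k! * h\<close> to \<open>c k (f z) * f'^n * h\<close> at \<open>z\<close>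
  (\<open>lin_op_transformed_divided_power\<close>).

  Because \<open>u\<close> vanishes at \<open>z\<close>, only the derivatives of \<open>u^k / k! * h\<close> of order at least \<open>k\<close>
  contribute.  For \<open>k = n - 1, n - 2, n - 3\<close> these are at most four derivatives, and they have
  closed forms that are polynomial in \<open>k\<close> (\<open>iter_deriv_divided_power_mult_0\<close> to
  \<open>iter_deriv_divided_power_mult_3\<close>).  In terms of the logarithmic derivatives \<open>p\<close> of \<open>f'\<close> and
  \<open>q\<close> of \<open>h\<close>, this gives a triangular system for \<open>Q (n - 1)\<close>, \<open>Q (n - 2)\<close>, \<open>Q (n - 3)\<close>
  (\<open>leading_coefficient_relations\<close>), valid at every \<open>z\<close> and therefore open to
  differentiation.  Once the derivatives of \<open>Q (n - 1)\<close> and \<open>Q (n - 2)\<close> are computed from it,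
  substitution into \<open>I_inv\<close> makes all occurrences of \<open>p\<close> and \<open>q\<close> cancel; this is a polynomial
  identity in \<open>n\<close> and the jets (\<open>I_inv_polynomial_identity\<close>).  What remains is homogeneous of
  weight 3 in \<open>f'\<close>.  Invariance under \<open>y = g w\<close> is the case \<open>f z = z\<close>.
\<close>

section \<open>Calculus of smooth functions\<close>

lemma smooth_on_imp_deriv:
  assumes "smooth_on f S" "x \<in> S"
  shows "(f has_field_derivative deriv f x) (at x)"
proof -
  have "((deriv ^^ 0) f) field_differentiable (at x)"
    using assms unfolding smooth_on_def by blast
  then show ?thesis by (simp add: field_differentiable_derivI)
qed

lemma smooth_on_deriv:
  assumes "smooth_on f S"
  shows "smooth_on (deriv f) S"
proof -
  have "(deriv ^^ k) (deriv f) = (deriv ^^ Suc k) f" for k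
    by (simp add: funpow_swap1)
  then show ?thesis
    using assms unfolding smooth_on_def by metis
qed

lemma iter_deriv_cong_on:
  assumes "open S" "\<And>x. x \<in> S \<Longrightarrow> f x = g x" "x \<in> S"
  shows "(deriv ^^ k) f x = (deriv ^^ k) g x"
  using assms by (intro higher_deriv_cong_ev) (auto simp: eventually_nhds)

text \<open>
  Smoothness is the largest class of differentiable functions that is closed under taking a
  derivative, so it may be proved by exhibiting any such class.
\<close>
lemma smooth_on_coinduct:
  assumes "open S" "C f"
    and step: "\<And>f. C f \<Longrightarrow> \<exists>f'. C f' \<and> (\<forall>x\<in>S. (f has_field_derivative f' x) (at x))"
  shows "smooth_on f S"
  unfolding smooth_on_def
proof (intro allI ballI)
  fix k x assume x: "x \<in> S"
  have "\<exists>f'. C f' \<and> (\<forall>x\<in>S. (deriv ^^ k) f x = f' x)"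
  proof (induction k)
    case 0 then show ?case using assms(2) by auto
  next
    case (Suc k)
    then obtain f1 where f1: "C f1" "\<And>x. x \<in> S \<Longrightarrow> (deriv ^^ k) f x = f1 x" by blast
    obtain f2 where f2: "C f2" "\<And>x. x \<in> S \<Longrightarrow> (f1 has_field_derivative f2 x) (at x)"
      using step f1(1) by blast
    have "(deriv ^^ Suc k) f x = f2 x" if "x \<in> S" for x
      using iter_deriv_cong_on[of S "(deriv ^^ k) f" f1 x 1] assms(1) f1(2) f2(2) that
      by (simp add: DERIV_imp_deriv)
    then show ?case using f2(1) by blast
  qed
  then obtain f1 where f1: "C f1" "\<And>x. x \<in> S \<Longrightarrow> (deriv ^^ k) f x = f1 x" by blast
  obtain f2 where f2: "\<And>x. x \<in> S \<Longrightarrow> (f1 has_field_derivative f2 x) (at x)"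
    using step f1(1) by blast
  have "((deriv ^^ k) f has_field_derivative f2 x) (at x)"
    by (rule has_field_derivative_transform_within_open[OF f2[OF x] assms(1) x])
       (simp add: f1(2))
  then show "((deriv ^^ k) f) field_differentiable (at x)"
    unfolding field_differentiable_def by blast
qed

text \<open>
  The derivative of a product or a reciprocal is again built from sums, products and
  reciprocals.  Closing the smooth functions under all three operations at once gives a class to
  which the coinduction principle applies, and so all closure properties together.
\<close>
inductive smooth_term :: "'a::real_normed_field set \<Rightarrow> ('a \<Rightarrow> 'a) \<Rightarrow> bool" for S where
  base: "smooth_on f S \<Longrightarrow> smooth_term S f"
| add: "smooth_term S f \<Longrightarrow> smooth_term S g \<Longrightarrow> smooth_term S (\<lambda>x. f x + g x)"
| mult: "smooth_term S f \<Longrightarrow> smooth_term S g \<Longrightarrow> smooth_term S (\<lambda>x. f x * g x)"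
| inverse: "smooth_term S f \<Longrightarrow> (\<And>x. x \<in> S \<Longrightarrow> f x \<noteq> 0) \<Longrightarrow> smooth_term S (\<lambda>x. inverse (f x))"

lemma smooth_on_const: "smooth_on (\<lambda>x. c) S"
proof -
  have "\<exists>d. (deriv ^^ k) (\<lambda>x. c) = (\<lambda>x::'a. d)" for k
    by (induction k) auto
  then show ?thesis unfolding smooth_on_def by (metis field_differentiable_const)
qed

lemma smooth_on_ident: "smooth_on (\<lambda>x. x) S"
proof -
  have "((deriv ^^ k) (\<lambda>x::'a. x)) field_differentiable (at x)" for k and x :: 'a
  proof (cases k)
    case 0 then show ?thesis by (simp add: field_differentiable_ident)
  next
    case (Suc j)
    have "(deriv ^^ k) (\<lambda>x::'a. x) = (deriv ^^ j) (\<lambda>x. 1)"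
      by (simp add: Suc funpow_swap1)
    then show ?thesis using smooth_on_const[of 1 UNIV] unfolding smooth_on_def by auto
  qed
  then show ?thesis unfolding smooth_on_def by blast
qed

lemma smooth_term_imp_smooth_on:
  assumes "open S" "smooth_term S f"
  shows "smooth_on f S"
proof (rule smooth_on_coinduct[of S "smooth_term S", OF assms])
  fix f assume "smooth_term S f"
  then show "\<exists>f'. smooth_term S f' \<and> (\<forall>x\<in>S. (f has_field_derivative f' x) (at x))"
  proof induction
    case (base f)
    then show ?case
      using smooth_on_deriv smooth_on_imp_deriv smooth_term.base by blast
  next
    case (add f g)
    then obtain f' g' where
      "smooth_term S f'" "smooth_term S g'"
      "\<And>x. x \<in> S \<Longrightarrow> (f has_field_derivative f' x) (at x)"
      "\<And>x. x \<in> S \<Longrightarrow> (g has_field_derivative g' x) (at x)"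
      by blast
    then show ?case
      by (intro exI[of _ "\<lambda>x. f' x + g' x"])
         (auto intro!: smooth_term.add DERIV_add)
  next
    case (mult f g)
    then obtain f' g' where
      "smooth_term S f'" "smooth_term S g'"
      "\<And>x. x \<in> S \<Longrightarrow> (f has_field_derivative f' x) (at x)"
      "\<And>x. x \<in> S \<Longrightarrow> (g has_field_derivative g' x) (at x)"
      by blast
    then show ?case using mult.hyps
      by (intro exI[of _ "\<lambda>x. f' x * g x + g' x * f x"])
         (auto intro!: smooth_term.add smooth_term.mult DERIV_mult)
  next
    case (inverse f)
    then obtain f' where f': "smooth_term S f'"
      "\<And>x. x \<in> S \<Longrightarrow> (f has_field_derivative f' x) (at x)"
      by blast
    have "smooth_term S (\<lambda>x. (- 1) * (inverse (f x) * f' x * inverse (f x)))"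
      using inverse.hyps f'(1)
      by (intro smooth_term.mult smooth_term.inverse smooth_term.base[OF smooth_on_const])
    moreover have "((\<lambda>x. inverse (f x)) has_field_derivative
        (- 1) * (inverse (f x) * f' x * inverse (f x))) (at x)" if "x \<in> S" for x
      using DERIV_inverse'[OF f'(2)[OF that] inverse.hyps(2)[OF that]] by simp
    ultimately show ?case by blast
  qed
qed

lemma smooth_on_add:
  assumes "open S" "smooth_on f S" "smooth_on g S"
  shows "smooth_on (\<lambda>x. f x + g x) S"
  using assms by (intro smooth_term_imp_smooth_on) (auto intro: smooth_term.intros)

lemma smooth_on_mult:
  assumes "open S" "smooth_on f S" "smooth_on g S"
  shows "smooth_on (\<lambda>x. f x * g x) S"
  using assms by (intro smooth_term_imp_smooth_on) (auto intro: smooth_term.intros)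

lemma smooth_on_inverse:
  assumes "open S" "smooth_on f S" "\<And>x. x \<in> S \<Longrightarrow> f x \<noteq> 0"
  shows "smooth_on (\<lambda>x. inverse (f x)) S"
  using assms by (intro smooth_term_imp_smooth_on) (auto intro: smooth_term.intros)

lemma smooth_on_diff:
  assumes "open S" "smooth_on f S" "smooth_on g S"
  shows "smooth_on (\<lambda>x. f x - g x) S"
  using smooth_on_add[OF assms(1,2) smooth_on_mult[OF assms(1) smooth_on_const[of "-1"] assms(3)]]
  by simp

lemma smooth_on_power:
  assumes "open S" "smooth_on f S"
  shows "smooth_on (\<lambda>x. f x ^ k) S"
  by (induction k) (auto intro: smooth_on_const smooth_on_mult assms)

lemma smooth_on_divide:
  assumes "open S" "smooth_on f S" "smooth_on g S" "\<And>x. x \<in> S \<Longrightarrow> g x \<noteq> 0"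
  shows "smooth_on (\<lambda>x. f x / g x) S"
  using smooth_on_mult[OF assms(1,2) smooth_on_inverse[OF assms(1,3,4)]]
  by (simp add: divide_inverse)

lemma iter_deriv_add:
  assumes "open S" "smooth_on f S" "smooth_on g S" "x \<in> S"
  shows "(deriv ^^ k) (\<lambda>x. f x + g x) x = (deriv ^^ k) f x + (deriv ^^ k) g x"
  using assms(2,3)
proof (induction k arbitrary: f g)
  case (Suc k)
  have "(deriv ^^ Suc k) (\<lambda>x. f x + g x) x = (deriv ^^ k) (deriv (\<lambda>x. f x + g x)) x"
    by (simp add: funpow_swap1)
  also have "\<dots> = (deriv ^^ k) (\<lambda>x. deriv f x + deriv g x) x"
    using Suc.prems
    by (intro iter_deriv_cong_on[OF assms(1) _ assms(4)] DERIV_imp_deriv DERIV_add)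
       (auto intro: smooth_on_imp_deriv)
  finally show ?case
    by (simp add: Suc.IH[OF Suc.prems[THEN smooth_on_deriv]] funpow_swap1)
qed simp

text \<open>
  The Leibniz rule is used one derivative at a time, because the formulas below are proved by
  recursion on the order of differentiation.
\<close>
lemma iter_deriv_mult_Suc:
  assumes "open S" "smooth_on f S" "smooth_on g S" "x \<in> S"
  shows "(deriv ^^ Suc k) (\<lambda>x. f x * g x) x =
    (deriv ^^ k) (\<lambda>x. deriv f x * g x) x + (deriv ^^ k) (\<lambda>x. f x * deriv g x) x"
proof -
  have "(deriv ^^ Suc k) (\<lambda>x. f x * g x) x = (deriv ^^ k) (deriv (\<lambda>x. f x * g x)) x"
    by (simp add: funpow_swap1)
  also have "\<dots> = (deriv ^^ k) (\<lambda>x. deriv f x * g x + f x * deriv g x) x"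
  proof (rule iter_deriv_cong_on[OF assms(1) _ assms(4)])
    fix y assume "y \<in> S"
    then show "deriv (\<lambda>x. f x * g x) y = deriv f y * g y + f y * deriv g y"
      using DERIV_mult[OF smooth_on_imp_deriv[OF assms(2)] smooth_on_imp_deriv[OF assms(3)]]
      by (intro DERIV_imp_deriv) (simp add: mult.commute)
  qed
  also have "\<dots> = (deriv ^^ k) (\<lambda>x. deriv f x * g x) x + (deriv ^^ k) (\<lambda>x. f x * deriv g x) x"
    using assms by (intro iter_deriv_add smooth_on_mult smooth_on_deriv)
  finally show ?thesis .
qed

lemma iter_deriv_cmult:
  assumes "open S" "smooth_on f S" "x \<in> S"
  shows "(deriv ^^ k) (\<lambda>x. c * f x) x = c * (deriv ^^ k) f x"
  using assms(2)
proof (induction k arbitrary: f)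
  case (Suc k)
  have "(deriv ^^ k) (\<lambda>x. 0 * f x) x = 0"
    by (induction k) (auto simp: funpow_swap1)
  then show ?case
    using iter_deriv_mult_Suc[OF assms(1) smooth_on_const Suc.prems assms(3), of k c]
      Suc.IH[OF smooth_on_deriv[OF Suc.prems]]
    by (simp add: funpow_swap1)
qed simp

section \<open>Jets of weighted divided powers\<close>

definition divided_power :: "('a::real_normed_field \<Rightarrow> 'a) \<Rightarrow> nat \<Rightarrow> 'a \<Rightarrow> 'a" where
  "divided_power u k x = u x ^ k / fact k"

lemma smooth_on_divided_power:
  assumes "open S" "smooth_on u S"
  shows "smooth_on (divided_power u k) S"
  unfolding divided_power_def
  using assms by (intro smooth_on_divide smooth_on_power smooth_on_const) auto

lemma deriv_divided_power_Suc:
  assumes "smooth_on u S" "x \<in> S"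
  shows "deriv (divided_power u (Suc k)) x = divided_power u k x * deriv u x"
proof -
  have "((\<lambda>x. u x ^ Suc k / fact (Suc k)) has_field_derivative
     (of_nat (Suc k) * (u x ^ k) * deriv u x) / fact (Suc k)) (at x)"
    using DERIV_cdivide[OF DERIV_power_Suc[OF smooth_on_imp_deriv[OF assms]], of k "fact (Suc k)"]
    by (simp add: algebra_simps)
  moreover have "(of_nat (Suc k) * (u x ^ k) * deriv u x) / fact (Suc k)
      = u x ^ k / fact k * deriv u x"
    by (simp add: field_simps del: of_nat_Suc)
  ultimately show ?thesis
    unfolding divided_power_def by (metis DERIV_imp_deriv)
qed

text \<open>
  The factor \<open>u'\<close> that differentiation of the power releases is absorbed into the weight \<open>h\<close>.
  This is why the weight is carried along: all the formulas below follow by induction with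
  \<open>h\<close> generalized.
\<close>
lemma iter_deriv_divided_power_mult_Suc:
  assumes "open S" "smooth_on u S" "smooth_on h S" "z \<in> S"
  shows "(deriv ^^ Suc j) (\<lambda>x. divided_power u (Suc k) x * h x) z =
    (deriv ^^ j) (\<lambda>x. divided_power u k x * (deriv u x * h x)) z +
    (deriv ^^ j) (\<lambda>x. divided_power u (Suc k) x * deriv h x) z"
  using iter_deriv_mult_Suc[OF assms(1) smooth_on_divided_power[OF assms(1,2)] assms(3,4)]
    iter_deriv_cong_on[OF assms(1) _ assms(4),
      of "\<lambda>x. deriv (divided_power u (Suc k)) x * h x"
         "\<lambda>x. divided_power u k x * (deriv u x * h x)"]
  by (simp add: deriv_divided_power_Suc[OF assms(2)] mult.assoc)

lemma iter_deriv_divided_power_mult_less: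
  assumes "open S" "smooth_on u S" "smooth_on h S" "z \<in> S" "u z = 0" "j < k"
  shows "(deriv ^^ j) (\<lambda>x. divided_power u k x * h x) z = 0"
  using assms(3,6)
proof (induction j arbitrary: k h)
  case 0
  then show ?case using assms(5) by (simp add: divided_power_def)
next
  case (Suc j)
  then obtain i where i: "k = Suc i" by (cases k) auto
  then show ?case
    using iter_deriv_divided_power_mult_Suc[OF assms(1,2) Suc.prems(1) assms(4), of j i]
      Suc.IH[of "\<lambda>x. deriv u x * h x" i] Suc.IH[of "deriv h" k] Suc.prems
    by (simp add: smooth_on_mult smooth_on_deriv assms del: funpow.simps)
qed

lemma iter_deriv_divided_power_mult_0:
  assumes "open S" "smooth_on u S" "smooth_on h S" "z \<in> S" "u z = 0"
  shows "(deriv ^^ k) (\<lambda>x. divided_power u k x * h x) z = deriv u z ^ k * h z"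
  using assms(3)
proof (induction k arbitrary: h)
  case 0
  then show ?case by (simp add: divided_power_def)
next
  case (Suc k)
  show ?case
    using iter_deriv_divided_power_mult_Suc[OF assms(1,2) Suc.prems(1) assms(4), of k k]
      Suc.IH[of "\<lambda>x. deriv u x * h x"] Suc.prems
      iter_deriv_divided_power_mult_less[OF assms(1,2) _ assms(4,5), of "deriv h" k "Suc k"]
    by (simp add: smooth_on_mult smooth_on_deriv assms mult_ac del: funpow.simps)
qed

text \<open>
  Derivatives of the factor \<open>a\<close> are recorded relative to its value, so that a power of \<open>u' = a\<close>
  can later be factored out of every term, also for exponents as small as \<open>k = 0\<close>.
\<close>
lemma iter_deriv_mult_relative:
  assumes "open S" "smooth_on a S" "smooth_on h S" "z \<in> S"
    and r1: "deriv a z = r1 * a z"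
  shows "deriv (\<lambda>x. a x * h x) z = a z * (deriv h z + r1 * h z)"
    and "(deriv ^^ 2) a z = r2 * a z \<Longrightarrow>
      (deriv ^^ 2) (\<lambda>x. a x * h x) z = a z * ((deriv ^^ 2) h z + 2 * r1 * deriv h z + r2 * h z)"
    and "(deriv ^^ 2) a z = r2 * a z \<Longrightarrow> (deriv ^^ 3) a z = r3 * a z \<Longrightarrow>
      (deriv ^^ 3) (\<lambda>x. a x * h x) z
      = a z * ((deriv ^^ 3) h z + 3 * r1 * (deriv ^^ 2) h z + 3 * r2 * deriv h z + r3 * h z)"
proof -
  note leibniz = iter_deriv_mult_Suc[OF assms(1) _ _ assms(4)]
  note a = assms(2) note a' = smooth_on_deriv[OF a] note a'' = smooth_on_deriv[OF a']
  note h = assms(3) note h' = smooth_on_deriv[OF h] note h'' = smooth_on_deriv[OF h']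
  show "deriv (\<lambda>x. a x * h x) z = a z * (deriv h z + r1 * h z)"
    using leibniz[OF a h, of 0] r1 by (simp add: algebra_simps)
  show "(deriv ^^ 2) (\<lambda>x. a x * h x) z
      = a z * ((deriv ^^ 2) h z + 2 * r1 * deriv h z + r2 * h z)"
    if "(deriv ^^ 2) a z = r2 * a z"
    using leibniz[OF a h, of 1] leibniz[OF a h', of 0] leibniz[OF a' h, of 0] r1 that
    by (simp add: eval_nat_numeral algebra_simps)
  show "(deriv ^^ 3) (\<lambda>x. a x * h x) z
      = a z * ((deriv ^^ 3) h z + 3 * r1 * (deriv ^^ 2) h z + 3 * r2 * deriv h z + r3 * h z)"
    if "(deriv ^^ 2) a z = r2 * a z" "(deriv ^^ 3) a z = r3 * a z"
    using leibniz[OF a h, of 2] leibniz[OF a h', of 1] leibniz[OF a' h, of 1]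
      leibniz[OF a h'', of 0] leibniz[OF a' h', of 0] leibniz[OF a'' h, of 0] r1 that
    by (simp add: eval_nat_numeral algebra_simps)
qed

text \<open>
  The coefficient of \<open>h\<close> in the next three lemmas is, up to the factor \<open>u' ^ k\<close>, the partial Bell
  polynomial \<open>B (k + i) k\<close> in the derivatives of \<open>u\<close> for \<open>i = 1, 2, 3\<close>; the other coefficients are
  Bell polynomials of smaller excess times binomial coefficients.  Written as polynomials in
  \<open>k\<close>, they let the final cancellation be checked for all orders \<open>n\<close> at once.
\<close>
lemma iter_deriv_divided_power_mult_1:
  assumes "open S" "smooth_on u S" "smooth_on h S" "z \<in> S" "u z = 0"
    and p: "deriv (deriv u) z = p1 * deriv u z"
  shows "(deriv ^^ Suc k) (\<lambda>x. divided_power u k x * h x) z = deriv u z ^ k *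
    ((of_nat k + 1) * deriv h z + (of_nat k + 1) * of_nat k / 2 * p1 * h z)"
  using assms(3)
proof (induction k arbitrary: h)
  case 0
  then show ?case by (simp add: divided_power_def)
next
  case (Suc k)
  note u' = smooth_on_deriv[OF assms(2)]
  note uh = iter_deriv_mult_relative[OF assms(1) u' Suc.prems assms(4) p]
  show ?case
    unfolding iter_deriv_divided_power_mult_Suc[OF assms(1,2) Suc.prems(1) assms(4)]
      Suc.IH[OF smooth_on_mult[OF assms(1) u' Suc.prems]] uh(1)
      iter_deriv_divided_power_mult_0[OF assms(1,2) smooth_on_deriv[OF Suc.prems] assms(4,5)]
    by (simp add: field_simps)
qed

lemma iter_deriv_divided_power_mult_2:
  assumes "open S" "smooth_on u S" "smooth_on h S" "z \<in> S" "u z = 0"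
    and p: "deriv (deriv u) z = p1 * deriv u z" "(deriv ^^ 2) (deriv u) z = p2 * deriv u z"
  shows "(deriv ^^ Suc (Suc k)) (\<lambda>x. divided_power u k x * h x) z = deriv u z ^ k *
    ((of_nat k + 2) * (of_nat k + 1) / 2 * (deriv ^^ 2) h z
     + (of_nat k + 2) * (of_nat k + 1) * of_nat k / 2 * p1 * deriv h z
     + (of_nat k + 2) * (of_nat k + 1) * of_nat k / 24
         * (4 * p2 + 3 * (of_nat k - 1) * p1 ^ 2) * h z)"
  using assms(3)
proof (induction k arbitrary: h)
  case 0
  then show ?case by (simp add: divided_power_def numeral_2_eq_2)
next
  case (Suc k)
  note u' = smooth_on_deriv[OF assms(2)]
  note uh = iter_deriv_mult_relative[OF assms(1) u' Suc.prems assms(4) p(1)]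
  have h'': "deriv (deriv h) z = (deriv ^^ 2) h z" by (simp add: numeral_2_eq_2)
  show ?case
    unfolding iter_deriv_divided_power_mult_Suc[OF assms(1,2) Suc.prems(1) assms(4)]
      Suc.IH[OF smooth_on_mult[OF assms(1) u' Suc.prems]] uh(1) uh(2)[OF p(2)]
      iter_deriv_divided_power_mult_1[OF assms(1,2) smooth_on_deriv[OF Suc.prems] assms(4,5) p(1)]
      h''
    by (simp add: field_simps power2_eq_square)
qed

lemma iter_deriv_divided_power_mult_3:
  assumes "open S" "smooth_on u S" "smooth_on h S" "z \<in> S" "u z = 0"
    and p: "deriv (deriv u) z = p1 * deriv u z" "(deriv ^^ 2) (deriv u) z = p2 * deriv u z"
      "(deriv ^^ 3) (deriv u) z = p3 * deriv u z"
  shows "(deriv ^^ Suc (Suc (Suc k))) (\<lambda>x. divided_power u k x * h x) z = deriv u z ^ k *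
    ((of_nat k + 3) * (of_nat k + 2) * (of_nat k + 1) / 6 * (deriv ^^ 3) h z
     + (of_nat k + 3) * (of_nat k + 2) * (of_nat k + 1) * of_nat k / 4 * p1 * (deriv ^^ 2) h z
     + (of_nat k + 3) * (of_nat k + 2) * (of_nat k + 1) * of_nat k / 24
         * (4 * p2 + 3 * (of_nat k - 1) * p1 ^ 2) * deriv h z
     + (of_nat k + 3) * (of_nat k + 2) * (of_nat k + 1) * of_nat k / 48
         * (2 * p3 + 4 * (of_nat k - 1) * p1 * p2
            + (of_nat k - 1) * (of_nat k - 2) * p1 ^ 3) * h z)"
  using assms(3)
proof (induction k arbitrary: h)
  case 0
  then show ?case by (simp add: divided_power_def numeral_3_eq_3)
next
  case (Suc k)
  note u' = smooth_on_deriv[OF assms(2)]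
  note uh = iter_deriv_mult_relative[OF assms(1) u' Suc.prems assms(4) p(1)]
  have h'': "deriv (deriv h) z = (deriv ^^ 2) h z" "(deriv ^^ 2) (deriv h) z = (deriv ^^ 3) h z"
    by (simp_all add: eval_nat_numeral)
  show ?case
    unfolding iter_deriv_divided_power_mult_Suc[OF assms(1,2) Suc.prems(1) assms(4)]
      Suc.IH[OF smooth_on_mult[OF assms(1) u' Suc.prems]] uh(1) uh(2)[OF p(2)] uh(3)[OF p(2,3)]
      iter_deriv_divided_power_mult_2[OF assms(1,2) smooth_on_deriv[OF Suc.prems] assms(4,5) p(1,2)]
      h''
    by (simp add: field_simps power2_eq_square power3_eq_cube)
qed

section \<open>The leading coefficients of the transformed equation\<close>

lemma smooth_on_subset: "smooth_on f T \<Longrightarrow> S \<subseteq> T \<Longrightarrow> smooth_on f S"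
  unfolding smooth_on_def by blast

lemma smooth_on_mult_divided_power:
  assumes "open S" "smooth_on u S" "smooth_on h S"
  shows "smooth_on (\<lambda>x. divided_power u k x * h x) S"
  using assms by (intro smooth_on_mult smooth_on_divided_power)

lemma lin_op_diff_cmult:
  assumes "open S" "smooth_on a S" "smooth_on b S" "x \<in> S"
  shows "lin_op n c (\<lambda>x. a x - s * b x) x = lin_op n c a x - s * lin_op n c b x"
proof -
  have D: "(deriv ^^ j) (\<lambda>x. a x - s * b x) x = (deriv ^^ j) a x - s * (deriv ^^ j) b x" for j
    using iter_deriv_add[OF assms(1,2) smooth_on_mult[OF assms(1) smooth_on_const assms(3)] assms(4),
        of j "- s"] iter_deriv_cmult[OF assms(1,3,4), of j "- s"]
    by simp
  show ?thesis
    by (simp add: lin_op_def D algebra_simps sum_subtractf sum_distrib_left)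
qed

lemma iter_deriv_divided_power_at_root:
  "(deriv ^^ j) (divided_power (\<lambda>x. x - a) k) a = (if j = k then 1 else 0)"
proof (induction j arbitrary: k)
  case 0
  then show ?case by (simp add: divided_power_def)
next
  case (Suc j)
  have s: "smooth_on (\<lambda>x. x - a) UNIV"
    by (intro smooth_on_diff smooth_on_ident smooth_on_const) auto
  have d: "deriv (\<lambda>x. x - a) x = 1" for x
    by (rule DERIV_imp_deriv) (auto intro!: derivative_eq_intros)
  show ?case
  proof (cases k)
    case 0
    have "(deriv ^^ j) (\<lambda>x. 0) a = 0" by (induction j) (auto simp: funpow_swap1)
    moreover have "divided_power (\<lambda>x. x - a) 0 = (\<lambda>x. 1)" by (simp add: divided_power_def fun_eq_iff)
    ultimately show ?thesis using 0 by (simp add: funpow_swap1)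
  next
    case (Suc i)
    have "deriv (divided_power (\<lambda>x. x - a) k) = divided_power (\<lambda>x. x - a) i"
      using deriv_divided_power_Suc[OF s, of _ i] by (simp add: fun_eq_iff Suc d)
    then show ?thesis using Suc.IH[of i] Suc by (simp add: funpow_swap1)
  qed
qed

lemma lin_op_divided_power_at_root:
  assumes "k \<le> n"
  shows "lin_op n c (divided_power (\<lambda>x. x - a) k) a = (if k = n then 1 else c k a)"
  using assms
  by (auto simp: lin_op_def iter_deriv_divided_power_at_root if_distrib sum.delta cong: if_cong)

text \<open>
  The hypothesis only compares the zero sets of the two operators.  The term of order \<open>n\<close> in the
  test function fixes the factor of proportionality, since both operators have leading
  coefficient 1.  Polynomials are used because they are smooth at every point of \<open>f ` J\<close>, a set
  that is not known to be open over a field that may be incomplete.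
\<close>
lemma lin_op_transformed_divided_power:
  assumes cov: "change_of_variables J f g" and tr: "transforms_into n J f g c Q"
    and z: "z \<in> J" and u_def: "u = (\<lambda>x. f x - f z)" and h_def: "h = (\<lambda>x. inverse (g x))"
    and k: "k < n"
  shows "lin_op n Q (\<lambda>x. divided_power u k x * h x) z = c k (f z) * (deriv u z ^ n * h z)"
proof -
  have J: "open J" "smooth_on f J" "smooth_on g J" "\<And>x. x \<in> J \<Longrightarrow> g x \<noteq> 0"
    using cov by (auto simp: change_of_variables_def)
  have u: "smooth_on u J" "u z = 0"
    unfolding u_def by (simp_all add: smooth_on_diff smooth_on_const J)
  have h: "smooth_on h J" unfolding h_def by (simp add: smooth_on_inverse J)
  define Y where "Y = divided_power (\<lambda>x. x - f z)"
  define W where "W = (\<lambda>j x. divided_power u j x * h x)"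
  have sY: "smooth_on (Y j) UNIV" for j
    unfolding Y_def by (intro smooth_on_divided_power smooth_on_diff smooth_on_ident smooth_on_const) auto
  have sW: "smooth_on (W j) J" for j
    unfolding W_def by (intro smooth_on_mult_divided_power J u h)
  \<comment> \<open>The second term is chosen so that the old operator annihilates \<open>y\<close> at \<open>f z\<close>.\<close>
  define y where "y = (\<lambda>x. Y k x - c k (f z) * Y n x)"
  define w where "w = (\<lambda>x. W k x - c k (f z) * W n x)"
  have "smooth_on y UNIV"
    unfolding y_def by (intro smooth_on_diff smooth_on_mult smooth_on_const sY) auto
  moreover have "smooth_on w J"
    unfolding w_def by (intro smooth_on_diff smooth_on_mult smooth_on_const sW J)
  moreover have "\<forall>x\<in>J. y (f x) = g x * w x"
    using J(4) by (simp add: y_def w_def Y_def W_def divided_power_def u_def h_def field_simps)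
  ultimately have iff: "lin_op n c y (f z) = 0 \<longleftrightarrow> lin_op n Q w z = 0"
    using tr z smooth_on_subset[of y UNIV "f ` J"] unfolding transforms_into_def by blast
  have "lin_op n c y (f z) = 0"
    unfolding y_def lin_op_diff_cmult[OF open_UNIV sY sY UNIV_I]
    using k by (simp add: Y_def lin_op_divided_power_at_root)
  then have "lin_op n Q (W k) z = c k (f z) * lin_op n Q (W n) z"
    using iff lin_op_diff_cmult[OF J(1) sW sW z, where s = "c k (f z)"] by (simp add: w_def)
  moreover have "lin_op n Q (W n) z = deriv u z ^ n * h z"
    using iter_deriv_divided_power_mult_0[OF J(1) u(1) h z u(2), of n]
      iter_deriv_divided_power_mult_less[OF J(1) u(1) h z u(2), of _ n]
    by (simp add: lin_op_def W_def)
  ultimately show ?thesis by (simp add: W_def)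
qed

text \<open>
  Expressing the jet through the logarithmic derivative is what makes the dependence on \<open>f\<close> and
  \<open>g\<close> polynomial, so that the final cancellation takes place in a polynomial ring.
\<close>
lemma log_derivative_jet:
  assumes "open S" "smooth_on a S" "\<forall>x\<in>S. a x \<noteq> 0" "x \<in> S"
    and r_def: "r = (\<lambda>x. deriv a x / a x)"
  shows "smooth_on r S" "deriv a x = r x * a x"
    "(deriv ^^ 2) a x = (deriv r x + r x ^ 2) * a x"
    "(deriv ^^ 3) a x = ((deriv ^^ 2) r x + 3 * r x * deriv r x + r x ^ 3) * a x"
proof -
  show r: "smooth_on r S"
    unfolding r_def using assms by (intro smooth_on_divide smooth_on_deriv) auto
  have 1: "deriv a y = r y * a y" if "y \<in> S" for y
    using assms(3) that by (simp add: r_def)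
  then show "deriv a x = r x * a x" using assms(4) .
  have c: "(deriv ^^ Suc k) a x = (deriv ^^ k) (\<lambda>x. r x * a x) x" for k
    using iter_deriv_cong_on[OF assms(1) _ assms(4), of "deriv a" "\<lambda>x. r x * a x" k] 1
    by (simp add: funpow_swap1)
  show 2: "(deriv ^^ 2) a x = (deriv r x + r x ^ 2) * a x"
    using c[of 1] iter_deriv_mult_Suc[OF assms(1) r assms(2,4), of 0] 1[OF assms(4)]
    by (simp add: numeral_2_eq_2 algebra_simps)
  show "(deriv ^^ 3) a x = ((deriv ^^ 2) r x + 3 * r x * deriv r x + r x ^ 3) * a x"
    using c[of 2] iter_deriv_mult_Suc[OF assms(1) r assms(2,4), of 1] 1[OF assms(4)] 2
      iter_deriv_mult_Suc[OF assms(1) smooth_on_deriv[OF r] assms(2,4), of 0]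
      iter_deriv_mult_Suc[OF assms(1) r smooth_on_deriv[OF assms(2)] assms(4), of 0]
    by (simp add: eval_nat_numeral algebra_simps)
qed

text \<open>
  The test functions with \<open>k = n - 1, n - 2, n - 3\<close>, where \<open>n = m + 3\<close>.  The parameter \<open>m\<close> keeps
  the three indices free of truncated subtraction.
\<close>
lemma leading_coefficient_relations:
  assumes cov: "change_of_variables J f g" and tr: "transforms_into (m + 3) J f g c Q"
    and h_def: "h = (\<lambda>x. inverse (g x))"
    and pq: "p = (\<lambda>x. deriv (deriv f) x / deriv f x)" "q = (\<lambda>x. deriv h x / h x)"
    and z: "z \<in> J"
  defines "F \<equiv> deriv f z" and "M \<equiv> of_nat m"
  shows "c (m + 2) (f z) * F = Q (m + 2) z + (M + 3) * q z + (M + 3) * (M + 2) / 2 * p z"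
      (is "?l1 = ?r1")
    and "c (m + 1) (f z) * F ^ 2 = Q (m + 1) z
      + Q (m + 2) z * ((M + 2) * q z + (M + 2) * (M + 1) / 2 * p z)
      + (M + 3) * (M + 2) / 2 * (deriv q z + q z ^ 2)
      + (M + 3) * (M + 2) * (M + 1) / 2 * p z * q z
      + (M + 3) * (M + 2) * (M + 1) / 24 * (4 * (deriv p z + p z ^ 2) + 3 * M * p z ^ 2)"
      (is "?l2 = ?r2")
    and "c m (f z) * F ^ 3 = Q m z
      + Q (m + 1) z * ((M + 1) * q z + (M + 1) * M / 2 * p z)
      + Q (m + 2) z * ((M + 2) * (M + 1) / 2 * (deriv q z + q z ^ 2)
        + (M + 2) * (M + 1) * M / 2 * p z * q z
        + (M + 2) * (M + 1) * M / 24 * (4 * (deriv p z + p z ^ 2) + 3 * (M - 1) * p z ^ 2))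
      + (M + 3) * (M + 2) * (M + 1) / 6 * ((deriv ^^ 2) q z + 3 * q z * deriv q z + q z ^ 3)
      + (M + 3) * (M + 2) * (M + 1) * M / 4 * p z * (deriv q z + q z ^ 2)
      + (M + 3) * (M + 2) * (M + 1) * M / 24
        * (4 * (deriv p z + p z ^ 2) + 3 * (M - 1) * p z ^ 2) * q z
      + (M + 3) * (M + 2) * (M + 1) * M / 48
        * (2 * ((deriv ^^ 2) p z + 3 * p z * deriv p z + p z ^ 3)
           + 4 * (M - 1) * p z * (deriv p z + p z ^ 2) + (M - 1) * (M - 2) * p z ^ 3)"
      (is "?l3 = ?r3")
proof -
  have J: "open J" "smooth_on f J" "smooth_on g J" "\<And>x. x \<in> J \<Longrightarrow> g x \<noteq> 0"
     "\<forall>x\<in>J. deriv f x \<noteq> 0"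
    using cov by (auto simp: change_of_variables_def)
  have h: "smooth_on h J" "\<forall>x\<in>J. h x \<noteq> 0"
    unfolding h_def by (simp_all add: smooth_on_inverse J)
  define u where "u = (\<lambda>x. f x - f z)"
  have u: "smooth_on u J" "u z = 0"
    unfolding u_def by (simp_all add: smooth_on_diff smooth_on_const J)
  have "deriv u x = deriv f x" if "x \<in> J" for x
    unfolding u_def using DERIV_diff[OF smooth_on_imp_deriv[OF J(2) that] DERIV_const]
    by (simp add: DERIV_imp_deriv)
  then have uf: "(deriv ^^ k) (deriv u) z = (deriv ^^ k) (deriv f) z" for k
    using iter_deriv_cong_on[OF J(1) _ z, of "deriv u" "deriv f" k] by simp
  note P = log_derivative_jet[OF J(1) smooth_on_deriv[OF J(2)] J(5) z pq(1)]
  note H = log_derivative_jet[OF J(1) h z pq(2)]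
  have U: "deriv u z = F" "deriv (deriv u) z = p z * deriv u z"
    "(deriv ^^ 2) (deriv u) z = (deriv p z + p z ^ 2) * deriv u z"
    "(deriv ^^ 3) (deriv u) z = ((deriv ^^ 2) p z + 3 * p z * deriv p z + p z ^ 3) * deriv u z"
    using uf[of 0] uf[of 1] uf[of 2] uf[of 3] P(2-4) by (simp_all add: F_def)
  note T = lin_op_transformed_divided_power[OF cov tr z u_def h_def, unfolded U(1)]
  note A0 = iter_deriv_divided_power_mult_0[OF J(1) u(1) h(1) z u(2), unfolded U(1)]
  note A1 = iter_deriv_divided_power_mult_1[OF J(1) u(1) h(1) z u(2) U(2), unfolded U(1)]
  note A2 = iter_deriv_divided_power_mult_2[OF J(1) u(1) h(1) z u(2) U(2,3), unfolded U(1)]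
  note A3 = iter_deriv_divided_power_mult_3[OF J(1) u(1) h(1) z u(2) U(2,3,4), unfolded U(1)]
  note less = iter_deriv_divided_power_mult_less[OF J(1) u(1) h(1) z u(2)]
  have F0: "F \<noteq> 0" "h z \<noteq> 0" using J(5) h z by (auto simp: F_def)
  have L: "lin_op (m + 3) Q y z = (deriv ^^ Suc (Suc (Suc m))) y z
      + ((\<Sum>j<m. Q j z * (deriv ^^ j) y z) + Q m z * (deriv ^^ m) y z
         + Q (Suc m) z * (deriv ^^ Suc m) y z + Q (Suc (Suc m)) z * (deriv ^^ Suc (Suc m)) y z)" for y
    by (simp add: lin_op_def numeral_3_eq_3 del: funpow.simps)
  let ?W = "\<lambda>k x. divided_power u k x * h x"
  have cancel: "a = b" if "lin_op (m + 3) Q (?W k) z = F ^ k * h z * b"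
      "lin_op (m + 3) Q (?W k) z = F ^ k * h z * a" for a b k
    using that F0 by simp
  have s: "of_nat (Suc (Suc m)) = M + 2" "of_nat (Suc m) = M + 1" "of_nat m = M"
      "m + 2 = Suc (Suc m)" "m + 1 = Suc m"
    by (simp_all add: M_def)
  have low: "(\<Sum>j<m. Q j z * (deriv ^^ j) (?W k) z) = 0" if "m \<le> k" for k
    using that by (intro sum.neutral) (simp add: less)
  show "?l1 = ?r1"
  proof (rule cancel)
    have low': "(\<Sum>j<m. Q j z * (deriv ^^ j) (?W (Suc (Suc m))) z) = 0"
      by (rule low) simp
    have zero: "(deriv ^^ m) (?W (Suc (Suc m))) z = 0" "(deriv ^^ (Suc m)) (?W (Suc (Suc m))) z = 0"
      by (auto intro: less simp del: funpow.simps)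
    define G where "G = F ^ (Suc (Suc m))"
    show "lin_op (m + 3) Q (?W (Suc (Suc m))) z = F ^ (Suc (Suc m)) * h z * ?r1"
      unfolding L
      unfolding low' zero A0[of "Suc (Suc m)"] A1[of "Suc (Suc m)"]
      unfolding H(2-4) s G_def[symmetric]
      by algebra
    show "lin_op (m + 3) Q (?W (Suc (Suc m))) z = F ^ (Suc (Suc m)) * h z * ?l1"
      using T[of "Suc (Suc m)"] by (simp add: power_add power2_eq_square power3_eq_cube mult_ac)
  qed
  show "?l2 = ?r2"
  proof (rule cancel)
    have low': "(\<Sum>j<m. Q j z * (deriv ^^ j) (?W (Suc m)) z) = 0"
      by (rule low) simp
    have zero: "(deriv ^^ m) (?W (Suc m)) z = 0"
      by (auto intro: less simp del: funpow.simps)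
    define G where "G = F ^ (Suc m)"
    show "lin_op (m + 3) Q (?W (Suc m)) z = F ^ (Suc m) * h z * ?r2"
      unfolding L
      unfolding low' zero A0[of "Suc m"] A1[of "Suc m"] A2[of "Suc m"]
      unfolding H(2-4) s G_def[symmetric]
      by algebra
    show "lin_op (m + 3) Q (?W (Suc m)) z = F ^ (Suc m) * h z * ?l2"
      using T[of "Suc m"] by (simp add: power_add power2_eq_square power3_eq_cube mult_ac)
  qed
  show "?l3 = ?r3"
  proof (rule cancel)
    have low': "(\<Sum>j<m. Q j z * (deriv ^^ j) (?W m) z) = 0"
      by (rule low) simp
    define G where "G = F ^ m"
    show "lin_op (m + 3) Q (?W m) z = F ^ m * h z * ?r3"
      unfolding L
      unfolding low' A0[of m] A1[of m] A2[of m] A3[of m]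
      unfolding H(2-4) s G_def[symmetric]
      by algebra
    show "lin_op (m + 3) Q (?W m) z = F ^ m * h z * ?l3"
      using T[of m] by (simp add: power_add power2_eq_square power3_eq_cube mult_ac)
  qed
qed

section \<open>Invariance\<close>

text \<open>
  The cancellation behind the theorem, with the functions replaced by indeterminates:
  \<open>a, b, g\<close> stand for \<open>Q (n - 1), Q (n - 2), Q (n - 3)\<close> and \<open>a1, a2, b1\<close> for derivatives of the
  first two; \<open>c1, c2, c3\<close> stand for the corresponding coefficients of the old equation multiplied
  by \<open>f', f'^2, f'^3\<close>, and \<open>c11, c12, c21\<close> for their derivatives with respect to \<open>x\<close>, multiplied
  by \<open>f'^2, f'^3, f'^3\<close>.  The hypotheses are the triangular system and its derivatives.
\<close>
lemma I_inv_polynomial_identity: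
  fixes N :: "'a::field_char_0"
  assumes "N \<noteq> 0"
    and A: "a = c1 - N * q - N * (N - 1) / 2 * p"
    and A1: "a1 = c11 + c1 * p - N * q1 - N * (N - 1) / 2 * p1"
    and A2: "a2 = c12 + 3 * c11 * p + c1 * (p1 + p ^ 2) - N * q2 - N * (N - 1) / 2 * p2"
    and B: "b = c2 - a * ((N - 1) * q + (N - 1) * (N - 2) / 2 * p)
      - N * (N - 1) / 2 * (q1 + q ^ 2) - N * (N - 1) * (N - 2) / 2 * p * q
      - N * (N - 1) * (N - 2) / 24 * (4 * (p1 + p ^ 2) + 3 * (N - 3) * p ^ 2)"
    and B1: "b1 = c21 + 2 * c2 * p
      - a1 * ((N - 1) * q + (N - 1) * (N - 2) / 2 * p)
      - a * ((N - 1) * q1 + (N - 1) * (N - 2) / 2 * p1)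
      - N * (N - 1) / 2 * (q2 + 2 * q * q1) - N * (N - 1) * (N - 2) / 2 * (p1 * q + p * q1)
      - N * (N - 1) * (N - 2) / 24 * (4 * (p2 + 2 * p * p1) + 6 * (N - 3) * p * p1)"
    and G: "g = c3 - b * ((N - 2) * q + (N - 2) * (N - 3) / 2 * p)
      - a * ((N - 1) * (N - 2) / 2 * (q1 + q ^ 2) + (N - 1) * (N - 2) * (N - 3) / 2 * p * q
          + (N - 1) * (N - 2) * (N - 3) / 24 * (4 * (p1 + p ^ 2) + 3 * (N - 4) * p ^ 2))
      - N * (N - 1) * (N - 2) / 6 * (q2 + 3 * q * q1 + q ^ 3)
      - N * (N - 1) * (N - 2) * (N - 3) / 4 * p * (q1 + q ^ 2)
      - N * (N - 1) * (N - 2) * (N - 3) / 24 * (4 * (p1 + p ^ 2) + 3 * (N - 4) * p ^ 2) * q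
      - N * (N - 1) * (N - 2) * (N - 3) / 48
        * (2 * (p2 + 3 * p * p1 + p ^ 3) + 4 * (N - 4) * p * (p1 + p ^ 2)
           + (N - 4) * (N - 5) * p ^ 3)"
  shows "(N - 2) / N * a * b - (N - 1) * (N - 2) / (3 * N ^ 2) * a ^ 3 + (N - 2) / 2 * b1
      - (N - 1) * (N - 2) / (2 * N) * a * a1 - (N - 1) * (N - 2) / 12 * a2 - g
    = (N - 2) / N * c1 * c2 - (N - 1) * (N - 2) / (3 * N ^ 2) * c1 ^ 3 + (N - 2) / 2 * c21
      - (N - 1) * (N - 2) / (2 * N) * c1 * c11 - (N - 1) * (N - 2) / 12 * c12 - c3"
  using assms(1) unfolding A A1 A2 B B1 G
  by (simp add: divide_simps) algebra

lemma smooth_on_DERIV_comp: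
  assumes "smooth_on a (f ` J)" "smooth_on f J" "x \<in> J"
  shows "((\<lambda>x. a (f x)) has_field_derivative deriv a (f x) * deriv f x) (at x)"
  using assms by (intro DERIV_chain2[OF smooth_on_imp_deriv smooth_on_imp_deriv]) auto

lemma deriv_eq_on:
  assumes "open S" "x \<in> S" "\<And>x. x \<in> S \<Longrightarrow> f x = g x" "(g has_field_derivative D) (at x)"
  shows "deriv f x = D"
  using iter_deriv_cong_on[OF assms(1) assms(3) assms(2), where k = 1]
    DERIV_imp_deriv[OF assms(4)] by simp

lemma I_inv_change_of_variables:
  assumes n: "n \<ge> 3" and cov: "change_of_variables J f g"
    and c: "smooth_coeffs n c (f ` J)" and Q: "smooth_coeffs n Q J"
    and tr: "transforms_into n J f g c Q" and z: "z \<in> J"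
  shows "I_inv n Q z = deriv f z ^ 3 * I_inv n c (f z)"
proof -
  obtain m where m: "n = m + 3" using n by (metis add.commute le_Suc_ex)
  have J: "open J" "smooth_on f J" "smooth_on g J" "\<And>x. x \<in> J \<Longrightarrow> g x \<noteq> 0"
     "\<forall>x\<in>J. deriv f x \<noteq> 0"
    using cov by (auto simp: change_of_variables_def)
  define F where "F = deriv f"
  define h where "h = (\<lambda>x. inverse (g x))"
  define p where "p = (\<lambda>x. deriv F x / F x)"
  define q where "q = (\<lambda>x. deriv h x / h x)"
  define M where "M = (of_nat m :: 'a)"
  have h: "smooth_on h J" "\<forall>x\<in>J. h x \<noteq> 0"
    unfolding h_def using J by (simp_all add: smooth_on_inverse)
  have F: "smooth_on F J" "\<forall>x\<in>J. F x \<noteq> 0"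
    unfolding F_def by (simp_all add: J smooth_on_deriv)
  have p: "smooth_on p J" and q: "smooth_on q J"
    using log_derivative_jet(1)[OF J(1) F z p_def] log_derivative_jet(1)[OF J(1) h z q_def] .
  have c1: "smooth_on (c (m + 2)) (f ` J)" and c2: "smooth_on (c (m + 1)) (f ` J)"
    using c by (auto simp: smooth_coeffs_def m)
  have Q1: "smooth_on (Q (m + 2)) J" using Q by (auto simp: smooth_coeffs_def m)
  note R = leading_coefficient_relations[OF cov tr[unfolded m] h_def p_def[unfolded F_def] q_def,
      folded F_def, folded M_def]
  have dF: "(F has_field_derivative p x * F x) (at x)" if "x \<in> J" for x
    using smooth_on_imp_deriv[OF F(1) that] log_derivative_jet(2)[OF J(1) F that p_def] by simp
  note dp = smooth_on_imp_deriv[OF p] and dp' = smooth_on_imp_deriv[OF smooth_on_deriv[OF p]]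
  note dq = smooth_on_imp_deriv[OF q] and dq' = smooth_on_imp_deriv[OF smooth_on_deriv[OF q]]
  note dQ = smooth_on_imp_deriv[OF Q1]
  note dc1 = smooth_on_DERIV_comp[OF c1 J(2), folded F_def]
  note dc1' = smooth_on_DERIV_comp[OF smooth_on_deriv[OF c1] J(2), folded F_def]
  note dc2 = smooth_on_DERIV_comp[OF c2 J(2), folded F_def]
  have two: "(deriv ^^ 2) f = deriv (deriv f)" for f :: "'a \<Rightarrow> 'a"
    by (simp add: numeral_2_eq_2)
  \<comment> \<open>Opaque names keep the coefficients from being rearranged during differentiation.\<close>
  define C1 C2 A B where "C1 = c (m + 2)" and "C2 = c (m + 1)"
    and "A = Q (m + 2)" and "B = Q (m + 1)"
  define K1 K2 K3 K4 where "K1 = (M + 3) * (M + 2) / 2" and "K2 = (M + 2) * (M + 1) / 2"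
    and "K3 = (M + 3) * (M + 2) * (M + 1) / 2" and "K4 = (M + 3) * (M + 2) * (M + 1) / 24"
  note names = C1_def C2_def A_def B_def and coeffs = K1_def K2_def K3_def K4_def
  note derivs = dF dp dq dp' dq' dQ[folded names] dc1[folded names] dc1'[folded names] dc2[folded names]
  have e1: "A x = C1 (f x) * F x - ((M + 3) * q x + K1 * p x)" if "x \<in> J" for x
    using R(1)[OF that, folded names coeffs] by (simp add: algebra_simps)
  have e1': "deriv A x = deriv C1 (f x) * F x ^ 2 + C1 (f x) * F x * p x
      - ((M + 3) * deriv q x + K1 * deriv p x)" if x: "x \<in> J" for x
    by (rule deriv_eq_on[OF J(1) x e1])
       (auto intro!: derivative_eq_intros derivs x simp: algebra_simps power2_eq_square)
  have e1'': "deriv (deriv A) z = deriv (deriv C1) (f z) * F z ^ 3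
      + 3 * deriv C1 (f z) * F z ^ 2 * p z + C1 (f z) * F z * (deriv p z + p z ^ 2)
      - ((M + 3) * deriv (deriv q) z + K1 * deriv (deriv p) z)"
    by (rule deriv_eq_on[OF J(1) z e1'])
       (auto intro!: derivative_eq_intros derivs z
          simp: algebra_simps power2_eq_square power3_eq_cube)
  have e2: "B x = C2 (f x) * F x ^ 2 - (A x * ((M + 2) * q x + K2 * p x)
      + K1 * (deriv q x + q x ^ 2) + K3 * p x * q x
      + K4 * (4 * (deriv p x + p x ^ 2) + 3 * M * p x ^ 2))" if "x \<in> J" for x
    using R(2)[OF that, folded names coeffs] by (simp add: add.assoc)
  have e2': "deriv B z = deriv C2 (f z) * F z ^ 3 + 2 * C2 (f z) * F z ^ 2 * p z
      - (deriv A z * ((M + 2) * q z + K2 * p z) + A z * ((M + 2) * deriv q z + K2 * deriv p z)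
      + K1 * (deriv (deriv q) z + 2 * q z * deriv q z)
      + K3 * (deriv p z * q z + p z * deriv q z)
      + K4 * (4 * (deriv (deriv p) z + 2 * p z * deriv p z) + 6 * M * p z * deriv p z))"
    by (rule deriv_eq_on[OF J(1) z e2])
       (auto intro!: derivative_eq_intros derivs z
          simp: algebra_simps power2_eq_square power3_eq_cube)
  have N: "of_nat n = M + 3" "n - 1 = m + 2" "n - 2 = m + 1" "n - 3 = m"
    by (simp_all add: m M_def)
  have "M + 3 = of_nat (m + 3)" by (simp add: M_def)
  then have N0: "M + 3 \<noteq> 0" by (metis of_nat_eq_0_iff add_is_0 zero_neq_numeral)
  have sh: "M + 3 - 1 = M + 2" "M + 3 - 2 = M + 1" "M + 3 - 3 = M" "M + 3 - 4 = M - 1"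
      "M + 3 - 5 = M - 2"
    by simp_all
  have "I_inv n Q z = (M + 1) / (M + 3) * (C1 (f z) * F z) * (C2 (f z) * F z ^ 2)
     - (M + 2) * (M + 1) / (3 * (M + 3) ^ 2) * (C1 (f z) * F z) ^ 3
     + (M + 1) / 2 * (deriv C2 (f z) * F z ^ 3)
     - (M + 2) * (M + 1) / (2 * (M + 3)) * (C1 (f z) * F z) * (deriv C1 (f z) * F z ^ 2)
     - (M + 2) * (M + 1) / 12 * (deriv (deriv C1) (f z) * F z ^ 3) - c m (f z) * F z ^ 3"
    unfolding I_inv_def N two sh names[symmetric]
    apply (rule I_inv_polynomial_identity[where N = "M + 3" and p = "p z" and q = "q z"
        and ?p1.0 = "deriv p z" and ?q1.0 = "deriv q z"
        and ?p2.0 = "deriv (deriv p) z" and ?q2.0 = "deriv (deriv q) z", unfolded sh, OF N0])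
    subgoal using e1[OF z] unfolding coeffs by algebra
    subgoal using e1'[OF z] unfolding coeffs by algebra
    subgoal using e1'' unfolding coeffs by algebra
    subgoal using e2[OF z] unfolding coeffs by algebra
    subgoal using e2' unfolding coeffs by algebra
    subgoal
      using R(3)[OF z, folded names] unfolding two diff_diff_eq eq_diff_eq add.assoc by (rule sym)
    done
  also have "\<dots> = deriv f z ^ 3 * I_inv n c (f z)"
    unfolding I_inv_def N two sh F_def names
    by (simp add: algebra_simps power2_eq_square power3_eq_cube)
  finally show ?thesis .
qed

lemma differential_expression_I_inv:
  assumes "n \<ge> 3"
  shows "differential_expression n (I_inv n :: (nat \<Rightarrow> 'a::real_normed_field \<Rightarrow> 'a) \<Rightarrow> 'a \<Rightarrow> 'a)"
proof -
  define \<Phi> :: "(nat \<Rightarrow> nat \<Rightarrow> 'a) \<Rightarrow> 'a" where "\<Phi> = (\<lambda>a.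
     (of_nat n - 2) / of_nat n * a (n - 1) 0 * a (n - 2) 0
     - (of_nat n - 1) * (of_nat n - 2) / (3 * of_nat n ^ 2) * a (n - 1) 0 ^ 3
     + (of_nat n - 2) / 2 * a (n - 2) 1
     - (of_nat n - 1) * (of_nat n - 2) / (2 * of_nat n) * a (n - 1) 0 * a (n - 1) 1
     - (of_nat n - 1) * (of_nat n - 2) / 12 * a (n - 1) 2
     - a (n - 3) 0)"
  have "I_inv n c x = \<Phi> (\<lambda>j k. if j < n \<and> k \<le> 2 then (deriv ^^ k) (c j) x else 0)" for c x
    using assms by (simp add: I_inv_def \<Phi>_def)
  then show ?thesis unfolding differential_expression_def by blast
qed

theorem mainTheorem8:
  fixes n :: nat
  assumes "n \<ge> 3"
  shows "semi_invariant n (I_inv n :: (nat \<Rightarrow> 'a::real_normed_field \<Rightarrow> 'a) \<Rightarrow> 'a \<Rightarrow> 'a) \<and>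
         has_index n (I_inv n :: (nat \<Rightarrow> 'a \<Rightarrow> 'a) \<Rightarrow> 'a \<Rightarrow> 'a) 3"
proof
  show index: "has_index n (I_inv n :: (nat \<Rightarrow> 'a \<Rightarrow> 'a) \<Rightarrow> 'a \<Rightarrow> 'a) 3"
    unfolding has_index_def using I_inv_change_of_variables[OF assms] by blast
  have "I_inv n Q x = I_inv n c x"
    if "change_of_variables J (\<lambda>x. x) g" "smooth_coeffs n c J" "smooth_coeffs n Q J"
      "transforms_into n J (\<lambda>x. x) g c Q" "x \<in> J" for J g c Q and x :: 'a
    using I_inv_change_of_variables[OF assms that(1) _ that(3-5)] that(2) by simp
  then show "semi_invariant n (I_inv n :: (nat \<Rightarrow> 'a \<Rightarrow> 'a) \<Rightarrow> 'a \<Rightarrow> 'a)"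
    unfolding semi_invariant_def using differential_expression_I_inv[OF assms] by blast
qed

end
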